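(* For any trees $T_1$ and $T_2$ of order $m$, every connected cograph $G$ with $\delta(G)\ge \left\lceil \frac{3\kappa(G)}{2}\right\rceil+m-1$ contains subtrees $T'_1\cong T_1$ and $T'_2\cong T_2$ with $V(T'_1)\cap V(T'_2)=\emptyset$ such that $\kappa\bigl(G-(V(T'_1)\cup V(T'_2))\bigr)=\kappa(G)$.
   Context: Graphs are simple and undirected. The order of a graph is its number of vertices; $\delta(G)$ is the minimum degree of $G$. Cographs are defined recursively: $K_1$ is a cograph; the disjoint union of cographs is a cograph; the join of cographs is a cograph, where the join $G_1+G_2$ of vertex-disjoint graphs is obtained from their disjoint union by adding all edges between $V(G_1)$ and $V(G_2)$. (Equivalently, cographs are the graphs with no induced path $P_4$ on four vertices.) The connectivity $\kappa(G)$ is the minimum number of vertices whose removal from $G$ results in a disconnected graph or a trivial graph (a graph of order 1); in particular $\kappa(K_1)=0$, although $K_1$ is connected. For a proper subset $S\subsetneq V(G)$, $G-S$ is the graph obtained by deleting all vertices of $S$. A subtree of $G$ is a (not necessarily induced) subgraph that is a tree.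
   Formalization: The formal theorem assumes in addition that G is not K_1: for G = K_1 and m = 1 the degree condition holds (0 ≥ 0+1-1), but K_1 has no two disjoint one-vertex subtrees; for m ≥ 2 the graph K_1 never meets the degree condition. *)

theory Defs
  imports Complex_Main "Graph_Theory.Graph_Theory"
begin

text \<open>
  A finite simple undirected graph is a \<^locale>\<open>pair_graph\<close>: finite, loop-free, with every edge
  represented by its two arcs \<open>(u,v)\<close> and \<open>(v,u)\<close>.  The unqualified name \<open>connected\<close> is shared
  with topology, hence the qualified \<^const>\<open>Digraph_Component.connected\<close>, which is false for
  the graph without vertices.
\<close>

text \<open>
  \<^const>\<open>Digraph_Component.tree\<close> is not usable for symmetric digraphs, since there the two arcs of
  an edge already form a cycle; the cycles of the undirected graph are those of length at least 3.
\<close>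

definition undirected_tree :: "'a pair_pre_digraph \<Rightarrow> bool" where
  "undirected_tree T \<longleftrightarrow> pair_graph T \<and> Digraph_Component.connected (with_proj T) \<and>
     \<not> (\<exists>p. pre_digraph.cycle (with_proj T) p \<and> length p \<ge> 3)"

definition subtree :: "'a pair_pre_digraph \<Rightarrow> 'a pair_pre_digraph \<Rightarrow> bool" where
  "subtree T G \<longleftrightarrow> undirected_tree T \<and> subgraph (with_proj T) (with_proj G)"

definition graph_union :: "'a pair_pre_digraph \<Rightarrow> 'a pair_pre_digraph \<Rightarrow> 'a pair_pre_digraph" where
  "graph_union G H = \<lparr> pverts = pverts G \<union> pverts H, parcs = parcs G \<union> parcs H \<rparr>"

definition graph_join :: "'a pair_pre_digraph \<Rightarrow> 'a pair_pre_digraph \<Rightarrow> 'a pair_pre_digraph" where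
  "graph_join G H = \<lparr> pverts = pverts G \<union> pverts H,
     parcs = parcs G \<union> parcs H \<union> pverts G \<times> pverts H \<union> pverts H \<times> pverts G \<rparr>"

inductive cograph :: "'a pair_pre_digraph \<Rightarrow> bool" where
  single: "cograph \<lparr> pverts = {v}, parcs = {} \<rparr>"
| union: "cograph G \<Longrightarrow> cograph H \<Longrightarrow> pverts G \<inter> pverts H = {} \<Longrightarrow> cograph (graph_union G H)"
| join: "cograph G \<Longrightarrow> cograph H \<Longrightarrow> pverts G \<inter> pverts H = {} \<Longrightarrow> cograph (graph_join G H)"

definition delete_verts :: "('a, 'b) pre_digraph \<Rightarrow> 'a set \<Rightarrow> ('a, 'b) pre_digraph" where
  "delete_verts G S = G \<restriction> (verts G - S)"

text \<open>In a symmetric digraph out-degree and in-degree agree with the degree of the graph.\<close>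

definition min_degree :: "('a, 'b) pre_digraph \<Rightarrow> nat" where
  "min_degree G = Min (out_degree G ` verts G)"

text \<open>
  Meaningful for finite graphs with at least one vertex only.  The one-vertex graph is connected and
  has connectivity and minimum degree 0.  It would satisfy a bound of the form
  \<open>min_degree G \<ge> \<lceil>3 * connectivity G / 2\<rceil> + m - 1\<close> for \<open>m = 1\<close>, although it does not contain
  two disjoint one-vertex trees; the main theorem therefore has to exclude it.
\<close>

definition connectivity :: "('a, 'b) pre_digraph \<Rightarrow> nat" where
  "connectivity G = (LEAST k. \<exists>S. S \<subset> verts G \<and> card S = k \<and>
     (\<not> Digraph_Component.connected (delete_verts G S) \<or> card (verts (delete_verts G S)) = 1))"

lemma cograph_imp_pair_graph: "cograph G \<Longrightarrow> pair_graph G"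
proof (induction rule: cograph.induct)
  case (single v)
  show ?case by unfold_locales (auto simp: symmetric_def sym_def)
next
  case (union G H)
  interpret G: pair_graph G by fact
  interpret H: pair_graph H by fact
  show ?case
    using G.pair_finite_verts G.pair_finite_arcs H.pair_finite_verts H.pair_finite_arcs
    by unfold_locales
      (auto simp: graph_union_def symmetric_def sym_def
        dest: G.in_arcsD1 G.in_arcsD2 H.in_arcsD1 H.in_arcsD2
          G.no_loops' H.no_loops' G.arcs_symmetric H.arcs_symmetric)
next
  case (join G H)
  interpret G: pair_graph G by fact
  interpret H: pair_graph H by fact
  show ?case
    using G.pair_finite_verts G.pair_finite_arcs H.pair_finite_verts H.pair_finite_arcs join.hyps
    by unfold_locales
      (auto simp: graph_join_def symmetric_def sym_def
        dest: G.in_arcsD1 G.in_arcsD2 H.in_arcsD1 H.in_arcsD2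
          G.no_loops' H.no_loops' G.arcs_symmetric H.arcs_symmetric)
qed

end

theory Submission
  imports Defs
begin

text \<open>
  In a cograph a minimum separating set \<open>S\<close> is completely joined to the rest \<open>W\<close>.  For the given
  degree bound \<open>W\<close> splits into two nonempty parts without edges between them, each of which has
  minimum degree at least \<open>m - 1\<close> and order at least \<open>\<kappa>/2 + m\<close>.  So one tree can be
  embedded greedily into each part, and what remains of \<open>W\<close> is still disconnected and has at
  least \<open>\<kappa> = |S|\<close> vertices.  A separating set with fewer than \<open>|S|\<close> vertices would leave vertices
  on both sides of the join, so \<open>S\<close> remains a minimum separating set.
\<close>

section \<open>Connectedness and cuts\<close>

text \<open>A walk that leaves \<open>A\<close> must use an arc out of \<open>A\<close>; conversely,
  the set of vertices reachable from \<open>u\<close> is a cut that no arc leaves. All later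
  connectedness arguments become statements about sets, except the tree argument, which needs an
  actual path.\<close>

lemma connected_iff_cut:
  "Digraph_Component.connected G \<longleftrightarrow> verts G \<noteq> {} \<and>
    (\<forall>A\<subset>verts G. A \<noteq> {} \<longrightarrow> (\<exists>a\<in>A. \<exists>b\<in>verts G - A. (a, b) \<in> (arcs_ends G)\<^sup>s))"
  (is "?L \<longleftrightarrow> ?R")
proof
  assume L: ?L
  have "\<exists>a\<in>A. \<exists>b\<in>verts G - A. (a, b) \<in> (arcs_ends G)\<^sup>s" if A: "A \<subset> verts G" "A \<noteq> {}" for A
  proof (rule ccontr)
    assume no: "\<not> ?thesis"
    obtain u v where uv: "u \<in> A" "v \<in> verts G - A" using A by blast
    then have "(u, v) \<in> rtrancl_on (verts G) ((arcs_ends G)\<^sup>s)"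
      using L A unfolding connected_conv by blast
    then have "v \<in> A" by (induction rule: rtrancl_on_induct) (use no uv in blast)+
    with uv show False by blast
  qed
  with L show ?R unfolding connected_conv by blast
next
  assume R: ?R
  have "(u, v) \<in> rtrancl_on (verts G) ((arcs_ends G)\<^sup>s)" if uv: "u \<in> verts G" "v \<in> verts G" for u v
  proof (rule ccontr)
    assume no: "\<not> ?thesis"
    define A where "A = {w. (u, w) \<in> rtrancl_on (verts G) ((arcs_ends G)\<^sup>s)}"
    have "A \<subset> verts G" "A \<noteq> {}"
      using no uv by (auto simp: A_def dest: in_rtrancl_on_in_F)
    then obtain a b where "a \<in> A" "b \<in> verts G - A" "(a, b) \<in> (arcs_ends G)\<^sup>s"
      using R by blast
    then show False by (auto simp: A_def intro: rtrancl_on_into_rtrancl_on)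
  qed
  with R show ?L unfolding connected_conv by blast
qed

lemma arcs_ends_induce: "arcs_ends (with_proj G \<restriction> W) = parcs G \<inter> W \<times> W"
  by (auto simp: arcs_ends_conv)

lemma (in pair_graph) symcl_induce: "(parcs G \<inter> W \<times> W)\<^sup>s = parcs G \<inter> W \<times> W"
  by (auto simp: symcl_def arcs_symmetric)

lemma (in pair_graph) connected_induce_iff:
  "Digraph_Component.connected (with_proj G \<restriction> W) \<longleftrightarrow> W \<noteq> {} \<and>
    (\<forall>A\<subset>W. A \<noteq> {} \<longrightarrow> (\<exists>a\<in>A. \<exists>b\<in>W - A. (a, b) \<in> parcs G))"
  unfolding connected_iff_cut arcs_ends_induce symcl_induce by simp blast

lemma (in pair_graph) obtain_cut:
  assumes "W \<noteq> {}" "\<not> Digraph_Component.connected (with_proj G \<restriction> W)"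
  obtains A where "A \<subset> W" "A \<noteq> {}" "\<forall>a\<in>A. \<forall>b\<in>W - A. (a, b) \<notin> parcs G"
  using assms unfolding connected_induce_iff by blast

lemma induce_induce: "U \<subseteq> W \<Longrightarrow> (G \<restriction> W) \<restriction> U = G \<restriction> U"
  by (auto simp: induce_subgraph_def)

lemma induce_verts:
  assumes "wf_digraph G" shows "G \<restriction> verts G = G"
proof -
  interpret wf_digraph G by fact
  show ?thesis by (rule pre_digraph.equality) auto
qed

lemma (in pair_graph) connected_join:
  assumes "X \<noteq> {}" "Y \<noteq> {}" "X \<times> Y \<subseteq> parcs G"
  shows "Digraph_Component.connected (with_proj G \<restriction> (X \<union> Y))"
proof -
  have "Y \<times> X \<subseteq> parcs G" using assms(3) by (auto simp: arcs_symmetric)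
  then show ?thesis
    using assms unfolding connected_induce_iff by blast
qed

section \<open>Minimum separating sets\<close>

definition separating :: "('a, 'b) pre_digraph \<Rightarrow> 'a set \<Rightarrow> bool" where
  "separating G S \<longleftrightarrow> S \<subset> verts G \<and>
     (\<not> Digraph_Component.connected (delete_verts G S) \<or> card (verts (delete_verts G S)) = 1)"

lemma connectivity_eq: "connectivity G = (LEAST k. \<exists>S. separating G S \<and> card S = k)"
  unfolding connectivity_def separating_def by (rule arg_cong[where f = Least]) auto

lemma connectivity_le: "separating G S \<Longrightarrow> connectivity G \<le> card S"
  unfolding connectivity_eq by (rule Least_le) blast

lemma obtain_min_separating:
  assumes "verts G \<noteq> {}"
  obtains S where "separating G S" "card S = connectivity G"
proof -
  \<comment> \<open>Deleting all vertices but one leaves a trivial graph, so the minimum in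
    \<open>connectivity_eq\<close> is taken over a nonempty set.\<close>
  obtain v where v: "v \<in> verts G" using assms by blast
  have "verts G - (verts G - {v}) = {v}" using v by blast
  then have "separating G (verts G - {v})"
    using v by (auto simp: separating_def delete_verts_def)
  then have "\<exists>k S. separating G S \<and> card S = k" by blast
  from LeastI_ex[OF this] show ?thesis
    using that unfolding connectivity_eq by blast
qed

text \<open>Used for the graph left after deleting both trees. The hypothesis \<open>le\<close>
  prevents a set smaller than \<open>S\<close> from swallowing all of \<open>U - S\<close>.\<close>

lemma (in pair_graph) connectivity_join:
  assumes fin: "finite U" and S: "S \<subset> U" "S \<times> (U - S) \<subseteq> parcs G"
    and disc: "\<not> Digraph_Component.connected (with_proj G \<restriction> (U - S))"
    and le: "card S \<le> card (U - S)"
  shows "connectivity (with_proj G \<restriction> U) = card S"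
proof (rule antisym)
  have "separating (with_proj G \<restriction> U) S"
    using S disc by (simp add: separating_def delete_verts_def induce_induce)
  then show "connectivity (with_proj G \<restriction> U) \<le> card S" by (rule connectivity_le)
  have "U \<noteq> {}" using S by blast
  then obtain S' where S': "separating (with_proj G \<restriction> U) S'"
    and card: "card S' = connectivity (with_proj G \<restriction> U)"
    using obtain_min_separating[of "with_proj G \<restriction> U"] by auto
  show "card S \<le> connectivity (with_proj G \<restriction> U)"
  proof (rule ccontr)
    assume "\<not> ?thesis"
    with card le have less: "card S' < card S" "card S' < card (U - S)" by auto
    have "S' \<subseteq> U" using S' by (simp add: separating_def psubset_eq)
    with fin have "finite S'" by (rule finite_subset[rotated])
    then have "\<not> S \<subseteq> S'" "\<not> U - S \<subseteq> S'" using less by (meson card_mono leD)+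
    then obtain x y where xy: "x \<in> S - S'" "y \<in> U - S - S'" by blast
    have "Digraph_Component.connected (with_proj G \<restriction> ((S - S') \<union> (U - S - S')))"
      by (rule connected_join) (use xy S in auto)
    \<comment> \<open>Since \<open>U - S'\<close> induces a connected graph, \<open>S'\<close> could
      only separate by leaving a single vertex; but \<open>x\<close> and \<open>y\<close> both
      survive and differ.\<close>
    moreover have U: "(S - S') \<union> (U - S - S') = U - S'" using S by blast
    ultimately have "card (U - S') = 1"
      using S' by (simp add: separating_def delete_verts_def induce_induce)
    then show False
      using xy S by (metis Diff_iff card_1_singletonE psubsetE singletonD subsetD)
  qed
qed

section \<open>Minimum separating sets of joins and cographs\<close>

lemma graph_join_commute: "graph_join G H = graph_join H G"
  by (auto simp: graph_join_def)

lemma induce_graph_join: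
  assumes "pair_graph H" "pverts G \<inter> pverts H = {}" "W \<subseteq> pverts G"
  shows "with_proj (graph_join G H) \<restriction> W = with_proj G \<restriction> W"
proof -
  interpret H: pair_graph H by fact
  have "a \<notin> W" if "(a, b) \<in> parcs H" for a b
    using assms(2,3) H.in_arcsD1[OF that] by blast
  then show ?thesis
    using assms(2,3) by (auto simp: induce_subgraph_def graph_join_def with_proj_def)
qed

lemma separating_graph_join:
  assumes "pair_graph H" "pverts G \<inter> pverts H = {}" "S \<subseteq> pverts G"
  shows "separating (with_proj (graph_join G H)) (S \<union> pverts H) \<longleftrightarrow> separating (with_proj G) S"
proof -
  have V: "pverts (graph_join G H) = pverts G \<union> pverts H" by (simp add: graph_join_def)
  have D: "pverts G \<union> pverts H - (S \<union> pverts H) = pverts G - S" using assms by blast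
  have "with_proj (graph_join G H) \<restriction> (pverts G - S) = with_proj G \<restriction> (pverts G - S)"
    by (rule induce_graph_join) (use assms in auto)
  then show ?thesis
    using assms(2,3) by (auto simp: separating_def delete_verts_def V D)
qed

text \<open>Since \<open>H\<close> is deleted entirely, only the part of \<open>S\<close> inside
  \<open>G\<close> matters, and it must be a minimum separating set of \<open>G\<close>: a smaller
  one together with \<open>H\<close> would beat \<open>S\<close>. Vertices of \<open>H\<close> see
  all of \<open>G\<close> by the join, the others see the rest by \<open>IH\<close>. The induction
  hypothesis is an assumption here so that both factors of a join can play the role of
  \<open>G\<close>.\<close>

lemma min_separating_graph_join:
  assumes GH: "cograph G" "cograph H" "pverts G \<inter> pverts H = {}"
    and IH: "\<And>S. separating (with_proj G) S \<Longrightarrow> card S = connectivity (with_proj G) \<Longrightarrow>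
      S \<times> (pverts G - S) \<subseteq> parcs G"
    and S: "separating (with_proj (graph_join G H)) S"
      "card S = connectivity (with_proj (graph_join G H))"
    and H: "pverts H \<subseteq> S"
  shows "S \<times> (pverts (graph_join G H) - S) \<subseteq> parcs (graph_join G H)"
proof -
  interpret G: pair_graph G using GH(1) by (rule cograph_imp_pair_graph)
  interpret H: pair_graph H using GH(2) by (rule cograph_imp_pair_graph)
  let ?J = "graph_join G H" and ?S = "S \<inter> pverts G"
  have V: "pverts ?J = pverts G \<union> pverts H" by (simp add: graph_join_def)
  have "S \<subset> pverts ?J" using S(1) by (simp add: separating_def)
  then have SU: "S = ?S \<union> pverts H" and W: "pverts ?J - S = pverts G - ?S" "pverts G - ?S \<noteq> {}"
    using H V by auto
  have sep: "separating (with_proj G) ?S"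
    using S(1) SU separating_graph_join[OF H.pair_graph GH(3), of ?S] by auto
  have "card ?S = connectivity (with_proj G)"
  proof (rule antisym)
    obtain S' where S': "separating (with_proj G) S'" "card S' = connectivity (with_proj G)"
      using obtain_min_separating[of "with_proj G"] W by auto
    have sub: "S' \<subseteq> pverts G" using S'(1) by (simp add: separating_def psubset_eq)
    have "separating (with_proj ?J) (S' \<union> pverts H)"
      using separating_graph_join[OF H.pair_graph GH(3) sub] S'(1) by simp
    then have "card S \<le> card (S' \<union> pverts H)" using S(2) connectivity_le by metis
    also have "\<dots> = card S' + card (pverts H)"
      using sub GH(3) by (intro card_Un_disjoint) (auto intro: finite_subset[OF _ G.pair_finite_verts])
    finally have "card S \<le> card S' + card (pverts H)" .
    moreover have "card S = card ?S + card (pverts H)"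
      using GH(3) by (subst SU, intro card_Un_disjoint) auto
    ultimately show "card ?S \<le> connectivity (with_proj G)" using S'(2) by simp
  qed (use sep connectivity_le in blast)
  from IH[OF sep this] have "?S \<times> (pverts G - ?S) \<subseteq> parcs G" .
  then show ?thesis using W SU by (auto simp: graph_join_def)
qed

text \<open>Induction over the construction. A disjoint union is already disconnected, so its
  minimum separating set is empty; in a join a separating set must contain one factor
  entirely.\<close>

lemma cograph_min_separating:
  assumes "cograph G" "separating (with_proj G) S" "card S = connectivity (with_proj G)"
  shows "S \<times> (pverts G - S) \<subseteq> parcs G"
  using assms
proof (induction arbitrary: S rule: cograph.induct)
  case (single v)
  then have "S = {}" by (auto simp: separating_def)
  then show ?case by simp
next
  case (union G H)
  have co: "cograph (graph_union G H)" using union.hyps by (rule cograph.union)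
  interpret J: pair_graph "graph_union G H" using co by (rule cograph_imp_pair_graph)
  interpret G: pair_graph G using union.hyps(1) by (rule cograph_imp_pair_graph)
  interpret H: pair_graph H using union.hyps(2) by (rule cograph_imp_pair_graph)
  \<comment> \<open>Nonempty factors make \<open>pverts G\<close> a genuine cut of the
    union.\<close>
  have ne: "pverts K \<noteq> {}" if "cograph K" for K :: "'a pair_pre_digraph"
    using that by induction (auto simp: graph_union_def graph_join_def)
  let ?J = "graph_union G H"
  have V: "pverts ?J = pverts G \<union> pverts H" by (simp add: graph_union_def)
  have "pverts G \<subset> pverts ?J" "pverts G \<noteq> {}"
    using V ne[OF union.hyps(1)] ne[OF union.hyps(2)] union.hyps(3) by auto
  moreover have "\<not> (\<exists>a\<in>pverts G. \<exists>b\<in>pverts ?J - pverts G. (a, b) \<in> parcs ?J)"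
    using union.hyps(3) by (auto simp: graph_union_def dest: G.in_arcsD2 H.in_arcsD1)
  ultimately have "\<not> Digraph_Component.connected (with_proj ?J \<restriction> pverts ?J)"
    unfolding J.connected_induce_iff by blast
  then have "separating (with_proj ?J) {}"
    using \<open>pverts G \<subset> pverts ?J\<close> by (auto simp: separating_def delete_verts_def)
  then have "card S = 0" using union.prems(2) connectivity_le by fastforce
  moreover have "finite S"
    using union.prems(1) by (auto simp: separating_def intro: finite_subset[OF _ J.pair_finite_verts])
  ultimately show ?case by simp
next
  case (join G H)
  have co: "cograph (graph_join G H)" using join.hyps by (rule cograph.join)
  interpret J: pair_graph "graph_join G H" using co by (rule cograph_imp_pair_graph)
  let ?J = "graph_join G H"
  have V: "pverts ?J = pverts G \<union> pverts H" by (simp add: graph_join_def)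
  consider "pverts H \<subseteq> S" | "pverts G \<subseteq> S" | "\<not> pverts G \<subseteq> S" "\<not> pverts H \<subseteq> S" by blast
  then show ?case
  proof cases
    case 1
    show ?thesis
      by (rule min_separating_graph_join[OF join.hyps join.IH(1) join.prems 1])
  next
    case 2
    have J: "?J = graph_join H G" by (rule graph_join_commute)
    have "pverts H \<inter> pverts G = {}" using join.hyps(3) by blast
    from min_separating_graph_join[OF join.hyps(2,1) this join.IH(2) join.prems[unfolded J] 2]
    show ?thesis unfolding J .
  next
    case 3
    \<comment> \<open>This case is impossible: survivors in both factors keep the rest connected and
      are at least two, so \<open>S\<close> would not separate.\<close>
    have "Digraph_Component.connected (with_proj ?J \<restriction> ((pverts G - S) \<union> (pverts H - S)))"
      by (rule J.connected_join) (use 3 in \<open>auto simp: graph_join_def\<close>)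
    moreover have U: "(pverts G - S) \<union> (pverts H - S) = pverts ?J - S" using V by blast
    ultimately have "card (pverts ?J - S) = 1"
      using join.prems(1) by (simp add: separating_def delete_verts_def)
    then obtain x where x: "pverts ?J - S = {x}" by (rule card_1_singletonE)
    obtain g h where "g \<in> pverts G - S" "h \<in> pverts H - S" using 3 by blast
    moreover from this have "g \<noteq> h" using join.hyps(3) by blast
    ultimately show ?thesis using U x by (metis Un_iff singletonD)
  qed
qed

section \<open>Greedy embedding of trees\<close>

text \<open>A second neighbour would close a cycle through \<open>A\<close>.\<close>

lemma undirected_tree_unique_neighbour:
  assumes T: "undirected_tree T" and A: "A \<subseteq> pverts T"
    and con: "Digraph_Component.connected (with_proj T \<restriction> A)"
    and b: "b \<notin> A" and a: "a \<in> A" "(a, b) \<in> parcs T" and a': "a' \<in> A" "(a', b) \<in> parcs T"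
  shows "a = a'"
proof (rule ccontr)
  assume neq: "a \<noteq> a'"
  interpret T: pair_graph T using T by (simp add: undirected_tree_def)
  interpret TA: wf_digraph "with_proj T \<restriction> A" by (rule T.wellformed_induce_subgraph)
  have "(a, a') \<in> rtrancl_on A (parcs T \<inter> A \<times> A)"
    using con a(1) a'(1) unfolding connected_conv arcs_ends_induce T.symcl_induce by simp
  then have "a \<rightarrow>\<^sup>*\<^bsub>with_proj T \<restriction> A\<^esub> a'"
    by (simp only: reachable_def arcs_ends_induce induce_subgraph_verts)
  then obtain p where p: "TA.apath a p a'" by (auto simp: TA.reachable_apath)
  have sub: "subgraph (with_proj T \<restriction> A) (with_proj T)"
    using A by (intro T.subgraph_induce_subgraphI)
  have pT: "T.apath a p a'" using p sub by (rule T.subgraph_apath_imp_apath)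
  \<comment> \<open>The path stays inside \<open>A\<close> and hence avoids \<open>b\<close>; this
    makes the closed walk below a cycle.\<close>
  have "set (TA.awalk_verts a p) \<subseteq> A"
    using p TA.awalk_verts_in_verts[of a p] by (auto simp: TA.apath_def TA.awalk_def)
  then have vA: "set (pawalk_verts a p) \<subseteq> A"
    using T.awalk_verts_induce by metis
  have ne: "p \<noteq> []" using pT neq by (auto simp: T.apath_Nil_iff)
  \<comment> \<open>From \<open>b\<close> to \<open>a\<close>, along \<open>p\<close> to
    \<open>a'\<close>, and back. Because \<open>p\<close> is nonempty, the length is at least 3, so
    this is a cycle of the undirected graph and not just an edge traversed back and forth.\<close>
  let ?c = "(b, a) # p @ [(a', b)]"
  have walk: "T.awalk b ?c b"
    using pT a a' by (auto simp: T.apath_def T.awalk_simps T.arcs_symmetric dest: T.in_arcsD2)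
  have "pawalk_verts a (p @ [(a', b)]) = pawalk_verts a p @ [b]"
    using pT T.awalk_verts_append[of a p "[(a', b)]" b] walk
    by (auto simp: T.apath_def T.awalk_simps)
  then have "distinct (tl (pawalk_verts b ?c))"
    using pT vA b by (auto simp: T.apath_def)
  with walk have "T.cycle ?c" unfolding T.cycle_def by blast
  moreover have "length ?c \<ge> 3" using ne by (cases p) auto
  ultimately show False using T unfolding undirected_tree_def by blast
qed

text \<open>A cut either splits \<open>A\<close> and is crossed by an arc within \<open>A\<close>,
  or has \<open>A\<close> on one side and \<open>b\<close> on the other and is crossed by the edge
  between \<open>a\<close> and \<open>b\<close>.\<close>

lemma (in pair_graph) connected_induce_insert:
  assumes con: "Digraph_Component.connected (with_proj G \<restriction> A)" and a: "a \<in> A" "(a, b) \<in> parcs G"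
  shows "Digraph_Component.connected (with_proj G \<restriction> insert b A)"
proof -
  have "\<exists>x\<in>B. \<exists>y\<in>insert b A - B. (x, y) \<in> parcs G" if B: "B \<subset> insert b A" "B \<noteq> {}" for B
  proof (cases "B \<inter> A = {} \<or> A \<subseteq> B")
    case True
    then show ?thesis using B a arcs_symmetric[of a b] by blast
  next
    case False
    then have "\<exists>x\<in>B \<inter> A. \<exists>y\<in>A - B \<inter> A. (x, y) \<in> parcs G"
      using con unfolding connected_induce_iff by blast
    then show ?thesis by blast
  qed
  then show ?thesis unfolding connected_induce_iff by blast
qed

text \<open>Greedy construction, adding one tree vertex at a time. Keeping \<open>A\<close>
  connected ensures that a new vertex has a unique neighbour in \<open>A\<close>, so its image has
  to respect only one edge. The bound \<open>deg\<close> says that each vertex of \<open>C\<close>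
  has at least \<open>card (pverts T) - 1\<close> neighbours in \<open>C\<close>.\<close>

lemma undirected_tree_partial_embedding:
  assumes T: "undirected_tree T" and G: "pair_graph G" and C: "C \<noteq> {}"
    and deg: "\<And>v. v \<in> C \<Longrightarrow> card (pverts T) \<le> Suc (card {w \<in> C. (v, w) \<in> parcs G})"
    and n: "n < card (pverts T)"
  shows "\<exists>A f. A \<subseteq> pverts T \<and> card A = Suc n \<and> Digraph_Component.connected (with_proj T \<restriction> A) \<and>
    inj_on f A \<and> f ` A \<subseteq> C \<and> (\<forall>a\<in>A. \<forall>b\<in>A. (a, b) \<in> parcs T \<longrightarrow> (f a, f b) \<in> parcs G)"
  using n
proof (induction n)
  interpret T: pair_graph T using T by (simp add: undirected_tree_def)
  case 0
  then obtain v where v: "v \<in> pverts T" by fastforce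
  obtain c where "c \<in> C" using C by blast
  moreover have "Digraph_Component.connected (with_proj T \<restriction> {v})"
    unfolding T.connected_induce_iff by blast
  ultimately show ?case
    using v by (intro exI[of _ "{v}"] exI[of _ "\<lambda>_. c"]) (auto dest: T.no_loops')
next
  interpret T: pair_graph T using T by (simp add: undirected_tree_def)
  interpret G: pair_graph G by fact
  case (Suc n)
  obtain A f where A: "A \<subseteq> pverts T" "card A = Suc n"
    and con: "Digraph_Component.connected (with_proj T \<restriction> A)"
    and f: "inj_on f A" "f ` A \<subseteq> C" "\<And>a b. (a, b) \<in> parcs T \<Longrightarrow> a \<in> A \<Longrightarrow> b \<in> A \<Longrightarrow> (f a, f b) \<in> parcs G"
    using Suc.IH[OF Suc_lessD[OF Suc.prems]] by (elim exE conjE) (rule that, assumption+, blast)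
  have finA: "finite A" using A(1) by (rule finite_subset) simp
  have "A \<subset> pverts T" "A \<noteq> {}" using A Suc.prems by auto
  moreover have "Digraph_Component.connected (with_proj T \<restriction> pverts T)"
    using T induce_verts[OF T.wf_digraph] by (simp add: undirected_tree_def)
  ultimately obtain a b where ab: "a \<in> A" "b \<in> pverts T - A" "(a, b) \<in> parcs T"
    unfolding T.connected_induce_iff by blast
  define N where "N = {w \<in> C. (f a, w) \<in> parcs G}"
  \<comment> \<open>As \<open>f a\<close> is not its own neighbour, at most \<open>n\<close>
    vertices of \<open>N\<close> are occupied, while \<open>deg\<close> and
    \<open>Suc n < card (pverts T)\<close> give at least \<open>n + 1\<close> candidates.\<close>
  have "f a \<notin> N" by (auto simp: N_def dest: G.no_loops')
  have "\<not> N \<subseteq> f ` A - {f a}"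
  proof
    assume "N \<subseteq> f ` A - {f a}"
    then have "card N \<le> card (f ` A - {f a})" using finA by (intro card_mono) auto
    also have "\<dots> = n" using ab(1) finA f(1) A(2) by (simp add: card_image)
    finally show False using deg[of "f a"] ab(1) f(2) Suc.prems unfolding N_def by fastforce
  qed
  with \<open>f a \<notin> N\<close> obtain c where c: "c \<in> N" "c \<notin> f ` A" by blast
  let ?f = "f(b := c)" and ?A = "insert b A"
  have uniq: "x = a" if "x \<in> A" "(x, b) \<in> parcs T" for x
    using undirected_tree_unique_neighbour[OF T A(1) con _ that ab(1,3)] ab(2) by blast
  have "(?f x, ?f y) \<in> parcs G" if "(x, y) \<in> parcs T" "x \<in> ?A" "y \<in> ?A" for x y
  proof -
    have "x \<noteq> y" using that(1) by (auto dest: T.no_loops')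
    moreover have "(f a, c) \<in> parcs G" "(c, f a) \<in> parcs G"
      using c by (auto simp: N_def G.arcs_symmetric)
    ultimately show ?thesis
      using that f(3)[of x y] uniq[of x] uniq[of y] T.arcs_symmetric[of x y] ab(2) by auto
  qed
  moreover have "inj_on ?f ?A" "?f ` ?A \<subseteq> C"
    using f c ab(2) by (auto simp: N_def inj_on_def)
  moreover have "?A \<subseteq> pverts T" "card ?A = Suc (Suc n)" using A ab finA by auto
  moreover have "Digraph_Component.connected (with_proj T \<restriction> ?A)"
    using con ab(1,3) by (rule T.connected_induce_insert)
  ultimately show ?case
    by (intro exI[of _ ?A] exI[of _ ?f]) blast
qed

section \<open>Trees under isomorphism\<close>

lemma (in wf_digraph) cycle_app_iso:
  assumes "cycle p" "digraph_isomorphism hom"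
  shows "pre_digraph.cycle (app_iso hom G) (map (iso_arcs hom) p)"
proof -
  obtain u where u: "awalk u p u" "distinct (tl (awalk_verts u p))" "p \<noteq> []"
    using assms(1) unfolding cycle_def by blast
  have "set (tl (awalk_verts u p)) \<subseteq> verts G"
    using u(1) by (meson awalkE' list.set_sel(2) awalk_verts_non_Nil subset_iff)
  then have "inj_on (iso_verts hom) (set (tl (awalk_verts u p)))"
    using digraph_isomorphism_inj_on_verts[OF assms(2)] inj_on_subset by blast
  then have "distinct (tl (map (iso_verts hom) (awalk_verts u p)))"
    using u(2) by (simp add: distinct_map map_tl[symmetric])
  then show ?thesis
    using awalk_app_isoI[OF u(1) assms(2)] awalk_verts_app_iso_eq[OF assms(2) u(1)] u(3)
    unfolding pre_digraph.cycle_def by auto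
qed

lemma undirected_tree_iso:
  assumes T: "undirected_tree T" and iso: "digraph_iso (with_proj T) (with_proj T')"
    and T': "pair_graph T'"
  shows "undirected_tree T'"
proof -
  interpret T: pair_graph T using T by (simp add: undirected_tree_def)
  interpret T': pair_graph T' by fact
  obtain h where "T.digraph_isomorphism h" "with_proj T' = app_iso h (with_proj T)"
    using iso unfolding digraph_iso_def by blast
  then have con: "Digraph_Component.connected (with_proj T')"
    using T T.connectedI_app_iso unfolding undirected_tree_def by metis
  \<comment> \<open>Acyclicity is pulled back: a cycle of \<open>T'\<close> is carried by the
    inverse isomorphism to a cycle of the same length in \<open>T\<close>.\<close>
  have "digraph_iso (with_proj T') (with_proj T)"
    using T.wf_digraph iso by (rule digraph_iso_swap)
  then obtain g where g: "T'.digraph_isomorphism g" "with_proj T = app_iso g (with_proj T')"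
    unfolding digraph_iso_def by blast
  have "\<not> (\<exists>p. T'.cycle p \<and> length p \<ge> 3)"
    using T T'.cycle_app_iso[OF _ g(1)] g(2) unfolding undirected_tree_def by (metis length_map)
  with con T' show ?thesis unfolding undirected_tree_def by blast
qed

lemma undirected_tree_embedding:
  assumes T: "undirected_tree T" and G: "pair_graph G" and C: "C \<noteq> {}" "C \<subseteq> pverts G"
    and deg: "\<And>v. v \<in> C \<Longrightarrow> card (pverts T) \<le> Suc (card {w \<in> C. (v, w) \<in> parcs G})"
  obtains T' where "subtree T' G" "digraph_iso (with_proj T) (with_proj T')" "pverts T' \<subseteq> C"
    "card (pverts T') = card (pverts T)"
proof -
  interpret T: pair_graph T using T by (simp add: undirected_tree_def)
  interpret G: pair_graph G by fact
  have "pverts T \<noteq> {}" using T by (simp add: undirected_tree_def connected_conv)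
  then have pos: "card (pverts T) - 1 < card (pverts T)" by (simp add: card_gt_0_iff)
  obtain A f where Af: "A \<subseteq> pverts T" "card A = card (pverts T)" "inj_on f A" "f ` A \<subseteq> C"
    "\<forall>a\<in>A. \<forall>b\<in>A. (a, b) \<in> parcs T \<longrightarrow> (f a, f b) \<in> parcs G"
    using undirected_tree_partial_embedding[OF T G C(1) deg pos] pos by auto
  have A: "A = pverts T" using Af(1,2) by (intro card_subset_eq) auto
  have inj: "inj_on f (pverts T)" and fC: "f ` pverts T \<subseteq> C" using Af A by auto
  have arcs: "(f a, f b) \<in> parcs G" if "(a, b) \<in> parcs T" for a b
    using Af(5) A that by (auto dest: T.in_arcsD1 T.in_arcsD2)
  \<comment> \<open>Only the images of tree arcs are taken; the subgraph of \<open>G\<close> induced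
    on these vertices may have further arcs and need not be a tree.\<close>
  define T' where "T' = \<lparr>pverts = f ` pverts T, parcs = map_prod f f ` parcs T\<rparr>"
  have T': "pair_graph T'"
  proof
    have "(y, x) \<in> parcs T'" if xy: "(x, y) \<in> parcs T'" for x y
    proof -
      obtain a b where "(a, b) \<in> parcs T" "x = f a" "y = f b"
        using xy by (auto simp: T'_def)
      then show ?thesis by (force simp: T'_def dest: T.arcs_symmetric)
    qed
    then show "symmetric (with_proj T')" by (auto simp: symmetric_def sym_def)
  next
    fix e assume "e \<in> parcs T'"
    then obtain a b where "(a, b) \<in> parcs T" "e = (f a, f b)" by (auto simp: T'_def)
    then show "fst e \<noteq> snd e" using G.no_loops'[OF arcs] by simp
  qed (auto simp: T'_def dest: T.in_arcsD1 T.in_arcsD2)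
  have "inj_on (map_prod f f) (parcs T)"
    by (rule inj_on_subset[OF map_prod_inj_on[OF inj inj]]) (auto dest: T.in_arcsD1 T.in_arcsD2)
  then have iso: "digraph_iso (with_proj T) (with_proj T')"
    unfolding digraph_iso_def pre_digraph.digraph_isomorphism_def
    using inj T.wf_digraph
    by (intro exI[of _ "\<lparr>iso_verts = f, iso_arcs = map_prod f f, iso_head = snd, iso_tail = fst\<rparr>"])
      (auto simp: T'_def app_iso_def with_proj_def)
  interpret T': pair_graph T' by fact
  have "subgraph (with_proj T') (with_proj G)"
    using fC C(2) arcs T'.wf_digraph G.wf_digraph
    by (intro subgraphI) (auto simp: T'_def compatible_def)
  then have "subtree T' G" using undirected_tree_iso[OF T iso T'] by (simp add: subtree_def)
  then show ?thesis
    using that[of T'] iso fC inj by (simp add: T'_def card_image)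
qed

section \<open>Degrees\<close>

lemma out_degree_with_proj: "out_degree (with_proj G) v = card {w. (v, w) \<in> parcs G}"
proof -
  have "out_arcs (with_proj G) v = Pair v ` {w. (v, w) \<in> parcs G}"
    by (auto simp: out_arcs_def)
  then show ?thesis by (simp add: out_degree_def card_image inj_on_def)
qed

text \<open>All neighbours of \<open>v\<close> lie in \<open>S\<close> or in \<open>A\<close>, and
  \<open>v\<close> is not among them. The first bound feeds the greedy embedding, both together
  bound the order of \<open>A\<close> from below.\<close>

lemma (in pair_graph) min_degree_part:
  assumes A: "A \<subseteq> pverts G" "S \<subseteq> pverts G" and no: "\<forall>a\<in>A. \<forall>b\<in>pverts G - S - A. (a, b) \<notin> parcs G"
    and v: "v \<in> A"
  shows "min_degree (with_proj G) \<le> card S + card {w \<in> A. (v, w) \<in> parcs G}"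
    and "card {w \<in> A. (v, w) \<in> parcs G} < card A"
proof -
  have fin: "finite S" "finite A" using A by (auto intro: finite_subset[OF _ pair_finite_verts])
  have "min_degree (with_proj G) \<le> card {w. (v, w) \<in> parcs G}"
    using v A by (auto simp: min_degree_def out_degree_with_proj[symmetric])
  also have "\<dots> \<le> card (S \<union> {w \<in> A. (v, w) \<in> parcs G})"
    using no v fin by (intro card_mono) (auto dest: in_arcsD2)
  also have "\<dots> \<le> card S + card {w \<in> A. (v, w) \<in> parcs G}" by (rule card_Un_le)
  finally show "min_degree (with_proj G) \<le> card S + card {w \<in> A. (v, w) \<in> parcs G}" .
  have "{w \<in> A. (v, w) \<in> parcs G} \<subset> A" using v by (auto dest: no_loops')
  then show "card {w \<in> A. (v, w) \<in> parcs G} < card A" using fin by (intro psubset_card_mono)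
qed

section \<open>Embedding both trees beside a minimum separating set\<close>

theorem theorem7:
  fixes G :: "'a pair_pre_digraph"
    and T1 :: "'b pair_pre_digraph"
    and T2 :: "'c pair_pre_digraph"
    and m :: nat
  assumes "undirected_tree T1" and "card (pverts T1) = m"
    and "undirected_tree T2" and "card (pverts T2) = m"
    and "cograph G"
    and "Digraph_Component.connected (with_proj G)"
    and "card (pverts G) \<noteq> 1"
    and "int (min_degree (with_proj G)) \<ge> \<lceil>3 * real (connectivity (with_proj G)) / 2\<rceil> + int m - 1"
  shows "\<exists>T1' T2'. subtree T1' G \<and> digraph_iso (with_proj T1) (with_proj T1') \<and>
    subtree T2' G \<and> digraph_iso (with_proj T2) (with_proj T2') \<and>
    pverts T1' \<inter> pverts T2' = {} \<and>
    pverts T1' \<union> pverts T2' \<subset> pverts G \<and>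
    connectivity (delete_verts (with_proj G) (pverts T1' \<union> pverts T2')) = connectivity (with_proj G)"
proof -
  interpret G: pair_graph G using assms(5) by (rule cograph_imp_pair_graph)
  let ?\<delta> = "min_degree (with_proj G)" and ?\<kappa> = "connectivity (with_proj G)"
  \<comment> \<open>The degree bound, doubled to remove the ceiling and rearranged to avoid
    subtraction on naturals.\<close>
  have bound: "3 * ?\<kappa> + 2 * m \<le> 2 * ?\<delta> + 2"
    using assms(8) by linarith
  have m: "m > 0"
    using assms(1,2) by (auto simp: undirected_tree_def connected_conv card_gt_0_iff pair_graph_def
        pair_digraph_def pair_fin_digraph_def pair_fin_digraph_axioms_def)
  have ne: "pverts G \<noteq> {}" using assms(6) by (simp add: connected_conv)
  then obtain S where S: "separating (with_proj G) S" "card S = ?\<kappa>"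
    using obtain_min_separating[of "with_proj G"] by auto
  have SV: "S \<subset> pverts G" using S(1) by (simp add: separating_def)
  have finS: "finite S" using SV by (auto intro: finite_subset[OF _ G.pair_finite_verts])
  let ?W = "pverts G - S"
  have join: "S \<times> ?W \<subseteq> parcs G" using assms(5) S by (rule cograph_min_separating)
  \<comment> \<open>A single remaining vertex would have all its neighbours in \<open>S\<close>, so
    the minimum degree would be at most the connectivity. With \<open>m > 0\<close> the bound then
    forces connectivity 0, and \<open>G\<close> would be the excluded one-vertex graph.\<close>
  have "card ?W \<noteq> 1"
  proof
    assume "card ?W = 1"
    then obtain v where v: "?W = {v}" by (rule card_1_singletonE)
    have "?\<delta> \<le> card S + card {w \<in> {v}. (v, w) \<in> parcs G}"
      by (rule G.min_degree_part) (use v SV in auto)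
    moreover have "card {w \<in> {v}. (v, w) \<in> parcs G} = 0"
      by (auto simp: card_eq_0_iff dest: G.no_loops')
    ultimately have "?\<delta> \<le> ?\<kappa>" using S(2) by linarith
    then have "?\<kappa> = 0" using bound m by linarith
    then have "S = {}" using S(2) finS by simp
    then show False using \<open>card ?W = 1\<close> assms(7) by simp
  qed
  then have disc: "\<not> Digraph_Component.connected (with_proj G \<restriction> ?W)"
    using S(1) by (simp add: separating_def delete_verts_def)
  then have "S \<noteq> {}" using assms(6) induce_verts[OF G.wf_digraph] by auto
  then have pos: "?\<kappa> > 0" using S(2) finS by (simp add: card_gt_0_iff flip: S(2))
  obtain A1 where A1: "A1 \<subset> ?W" "A1 \<noteq> {}" "\<forall>a\<in>A1. \<forall>b\<in>?W - A1. (a, b) \<notin> parcs G"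
    using G.obtain_cut[OF _ disc] SV by (metis Diff_eq_empty_iff psubsetE)
  define A2 where "A2 = ?W - A1"
  have A2: "A2 \<noteq> {}" "A2 \<subseteq> ?W" "\<forall>a\<in>A2. \<forall>b\<in>?W - A2. (a, b) \<notin> parcs G" "A1 \<inter> A2 = {}"
    using A1 by (auto simp: A2_def dest: G.arcs_symmetric)
  \<comment> \<open>If \<open>v\<close> has d neighbours in \<open>A\<close>, then
    \<open>bound\<close> and \<open>?\<delta> \<le> ?\<kappa> + d\<close> give
    \<open>?\<kappa> + 2 * m \<le> 2 * d + 2\<close>; and d is less than
    \<open>card A\<close>.\<close>
  have part: "m \<le> Suc (card {w \<in> A. (v, w) \<in> parcs G})" "?\<kappa> + 2 * m \<le> 2 * card A"
    if A: "A \<subseteq> ?W" "\<forall>a\<in>A. \<forall>b\<in>?W - A. (a, b) \<notin> parcs G" "v \<in> A" for A v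
  proof -
    have "A \<subseteq> pverts G" using A(1) by blast
    note * = G.min_degree_part[OF this psubset_imp_subset[OF SV] A(2,3)]
    show "m \<le> Suc (card {w \<in> A. (v, w) \<in> parcs G})" "?\<kappa> + 2 * m \<le> 2 * card A"
      using * bound S(2) by linarith+
  qed
  obtain T1' where T1': "subtree T1' G" "digraph_iso (with_proj T1) (with_proj T1')"
      "pverts T1' \<subseteq> A1" "card (pverts T1') = m"
    by (rule undirected_tree_embedding[OF assms(1) G.pair_graph A1(2)])
      (use A1 part(1)[of A1] assms(2) in auto)
  obtain T2' where T2': "subtree T2' G" "digraph_iso (with_proj T2) (with_proj T2')"
      "pverts T2' \<subseteq> A2" "card (pverts T2') = m"
    by (rule undirected_tree_embedding[OF assms(3) G.pair_graph A2(1)])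
      (use A2 part(1)[of A2] assms(4) in auto)
  define X where "X = pverts T1' \<union> pverts T2'"
  have fin: "finite A1" "finite A2" using A1(1) by (auto simp: A2_def intro: finite_subset[OF _ G.pair_finite_verts])
  \<comment> \<open>Each part keeps at least half of \<open>?\<kappa>\<close> vertices after losing
    its tree. Since \<open>?\<kappa>\<close> is positive, both leftovers are nonempty, and together
    they have at least \<open>card S\<close> vertices.\<close>
  have rest: "?\<kappa> \<le> 2 * card (A - B)"
    if A: "A \<subseteq> ?W" "\<forall>a\<in>A. \<forall>b\<in>?W - A. (a, b) \<notin> parcs G" "A \<noteq> {}" "finite A"
      and B: "B \<subseteq> A" "card B = m" for A B
  proof -
    obtain v where "v \<in> A" using A(3) by blast
    from part(2)[OF A(1,2) this] show ?thesis
      using B card_Diff_subset[of B A] finite_subset[OF B(1) A(4)] by linarith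
  qed
  have R1: "?\<kappa> \<le> 2 * card (A1 - pverts T1')" and R2: "?\<kappa> \<le> 2 * card (A2 - pverts T2')"
    using rest A1 A2 fin T1'(3,4) T2'(3,4) by blast+
  have R: "A1 - pverts T1' \<noteq> {}" "A2 - pverts T2' \<noteq> {}" using R1 R2 pos by fastforce+
  let ?U = "pverts G - X"
  have XW: "X \<subseteq> ?W" using T1'(3) T2'(3) A1(1) A2(2) by (auto simp: X_def)
  have W': "?U - S = (A1 - pverts T1') \<union> (A2 - pverts T2')"
    using T1'(3) T2'(3) A1(1) A2(4) SV by (auto simp: X_def A2_def)
  \<comment> \<open>The trees avoid \<open>S\<close>, so \<open>S\<close> is still joined to
    everything else in \<open>?U\<close>; the two leftovers show that \<open>?U - S\<close> is
    disconnected.\<close>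
  have "connectivity (with_proj G \<restriction> ?U) = card S"
  proof (rule G.connectivity_join)
    have "A1 - pverts T1' \<subset> ?U - S" using W' R A2(4) by blast
    moreover have "\<not> (\<exists>a\<in>A1 - pverts T1'. \<exists>b\<in>?U - S - (A1 - pverts T1'). (a, b) \<in> parcs G)"
      unfolding W' using A1(3) A2(2,4) by blast
    ultimately show "\<not> Digraph_Component.connected (with_proj G \<restriction> (?U - S))"
      using R unfolding G.connected_induce_iff by blast
    have "card (?U - S) = card (A1 - pverts T1') + card (A2 - pverts T2')"
      unfolding W' using fin A2(4) by (intro card_Un_disjoint) auto
    then show "card S \<le> card (?U - S)" using R1 R2 S(2) by linarith
  qed (use join XW SV W' R in auto)
  then have "connectivity (delete_verts (with_proj G) X) = ?\<kappa>"
    using S(2) by (simp add: delete_verts_def)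
  moreover have "X \<subset> pverts G" using XW SV \<open>S \<noteq> {}\<close> by blast
  moreover have "pverts T1' \<inter> pverts T2' = {}" using T1'(3) T2'(3) A2(4) by blast
  ultimately show ?thesis
    using T1'(1,2) T2'(1,2) unfolding X_def by blast
qed

end
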